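(* Let $X \neq \{0\}$ be a real Banach space and let $(L,\tau)$ be a non-empty locally compact Hausdorff space without isolated points. Then each linear operator $T\colon C_{0}(L,X)\rightarrow C_{0}(L,X)$ whose range does not contain an isomorphic copy of $c_{00}$ satisfies the Daugavet equality \[\|\mathbf{I}+T\|=1+\|T\|,\] where $\mathbf{I}$ is the identity operator on $C_{0}(L,X)$.
   Context: $C_{0}(L,X)$ denotes the Banach space of continuous functions $F\colon L\to X$ vanishing at infinity (for each $\varepsilon>0$ the set $\{t\in L: \|F(t)\|\geq\varepsilon\}$ is compact), with the norm $\|F\|_\infty=\sup_{t\in L}\|F(t)\|$. $c_{00}$ denotes the normed space of finitely supported real sequences with the supremum norm. A normed space contains an isomorphic copy of $c_{00}$ if it has a linear subspace that is linearly homeomorphic to $c_{00}$. For a linear operator $S$ on $C_0(L,X)$, $\|S\|=\sup\{\|SF\|_\infty : \|F\|_\infty\leq 1\}\in[0,\infty]$; the value $\infty$ is allowed, with $1+\infty=\infty$. *)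

theory Defs
  imports "HOL-Analysis.Analysis"
begin

section \<open>The space $C_0(L,X)$\<close>

definition vanishing_at_infinity ::
    "('a::topological_space \<Rightarrow> 'b::real_normed_vector) \<Rightarrow> bool" where
  "vanishing_at_infinity F \<longleftrightarrow> (\<forall>\<epsilon>>0. compact {t. norm (F t) \<ge> \<epsilon>})"

typedef (overloaded) ('a::topological_space, 'b::real_normed_vector) C0 =
  "{F :: 'a \<Rightarrow> 'b. continuous_on UNIV F \<and> vanishing_at_infinity F}"
  morphisms apply_C0 Abs_C0
  by (rule exI[of _ "\<lambda>_. 0"]) (simp add: vanishing_at_infinity_def)

setup_lifting type_definition_C0

lemma continuous_on_apply_C0: "continuous_on UNIV (apply_C0 F)"
  and vanishing_apply_C0: "vanishing_at_infinity (apply_C0 F)"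
  using apply_C0[of F] by auto

lemma vanishing_at_infinity_add:
  fixes F G :: "'a::topological_space \<Rightarrow> 'b::real_normed_vector"
  assumes "continuous_on UNIV F" "vanishing_at_infinity F"
    and "continuous_on UNIV G" "vanishing_at_infinity G"
  shows "vanishing_at_infinity (\<lambda>t. F t + G t)"
  unfolding vanishing_at_infinity_def
proof (intro allI impI)
  fix \<epsilon> :: real assume "\<epsilon> > 0"
  let ?K = "{t. norm (F t) \<ge> \<epsilon> / 2} \<union> {t. norm (G t) \<ge> \<epsilon> / 2}"
  let ?C = "{t. norm (F t + G t) \<ge> \<epsilon>}"
  have "compact ?K"
    using assms(2,4) half_gt_zero[OF \<open>\<epsilon> > 0\<close>]
    unfolding vanishing_at_infinity_def by (intro compact_Un) blast+
  moreover have "closed ?C"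
    using assms by (intro closed_Collect_le continuous_intros) auto
  moreover have "?K \<inter> ?C = ?C"
  proof -
    have "\<epsilon> \<le> norm (F t) + norm (G t)" if "\<epsilon> \<le> norm (F t + G t)" for t
      using that norm_triangle_ineq[of "F t" "G t"] by linarith
    then show ?thesis by fastforce
  qed
  ultimately show "compact ?C" using compact_Int_closed[of ?K ?C] by simp
qed

lemma vanishing_at_infinity_scaleR:
  fixes F :: "'a::topological_space \<Rightarrow> 'b::real_normed_vector"
  assumes "vanishing_at_infinity F"
  shows "vanishing_at_infinity (\<lambda>t. c *\<^sub>R F t)"
proof (cases "c = 0")
  case True
  then show ?thesis by (simp add: vanishing_at_infinity_def)
next
  case False
  have "{t. norm (c *\<^sub>R F t) \<ge> \<epsilon>} = {t. norm (F t) \<ge> \<epsilon> / \<bar>c\<bar>}" for \<epsilon>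
    using False by (simp add: field_simps)
  then show ?thesis
    using assms False by (simp add: vanishing_at_infinity_def)
qed

lemma bdd_above_apply_C0: "bdd_above (range (\<lambda>t. norm (apply_C0 F t)))"
proof -
  let ?K = "{t. norm (apply_C0 F t) \<ge> 1}"
  have "compact ?K"
    using vanishing_apply_C0[of F] by (simp add: vanishing_at_infinity_def)
  moreover have "continuous_on ?K (\<lambda>t. norm (apply_C0 F t))"
    by (intro continuous_intros continuous_on_subset[OF continuous_on_apply_C0]) auto
  ultimately have "bdd_above ((\<lambda>t. norm (apply_C0 F t)) ` ?K)"
    by (metis bounded_imp_bdd_above compact_continuous_image compact_imp_bounded)
  then obtain M where M: "\<And>t. norm (apply_C0 F t) \<ge> 1 \<Longrightarrow> norm (apply_C0 F t) \<le> M"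
    unfolding bdd_above_def by blast
  have "norm (apply_C0 F t) \<le> max 1 M" for t
    using M[of t] by linarith
  then show ?thesis by (intro bdd_aboveI[of _ "max 1 M"]) auto
qed

instantiation C0 :: (topological_space, real_normed_vector) real_vector
begin

lift_definition zero_C0 :: "('a, 'b) C0" is "\<lambda>_. 0"
  by (simp add: vanishing_at_infinity_def)

lift_definition plus_C0 :: "('a, 'b) C0 \<Rightarrow> ('a, 'b) C0 \<Rightarrow> ('a, 'b) C0"
  is "\<lambda>F G t. F t + G t"
  by (auto intro!: continuous_intros vanishing_at_infinity_add)

lift_definition scaleR_C0 :: "real \<Rightarrow> ('a, 'b) C0 \<Rightarrow> ('a, 'b) C0"
  is "\<lambda>c F t. c *\<^sub>R F t"
  by (auto intro!: continuous_intros vanishing_at_infinity_scaleR)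

lift_definition uminus_C0 :: "('a, 'b) C0 \<Rightarrow> ('a, 'b) C0"
  is "\<lambda>F t. - F t"
  using vanishing_at_infinity_scaleR[of _ "-1"] by (auto intro!: continuous_intros)

lift_definition minus_C0 :: "('a, 'b) C0 \<Rightarrow> ('a, 'b) C0 \<Rightarrow> ('a, 'b) C0"
  is "\<lambda>F G t. F t - G t"
  using vanishing_at_infinity_add[OF _ _ _ vanishing_at_infinity_scaleR[of _ "-1"]]
  by (auto intro!: continuous_intros)

instance
  by standard (transfer, simp add: fun_eq_iff algebra_simps)+

end

instantiation C0 :: (topological_space, real_normed_vector) real_normed_vector
begin

definition norm_C0 :: "('a, 'b) C0 \<Rightarrow> real" where
  "norm_C0 F = (SUP t. norm (apply_C0 F t))"

definition dist_C0 :: "('a, 'b) C0 \<Rightarrow> ('a, 'b) C0 \<Rightarrow> real" where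
  "dist_C0 F G = norm (F - G)"

definition sgn_C0 :: "('a, 'b) C0 \<Rightarrow> ('a, 'b) C0" where
  "sgn_C0 F = inverse (norm F) *\<^sub>R F"

definition uniformity_C0 :: "(('a, 'b) C0 \<times> ('a, 'b) C0) filter" where
  "uniformity_C0 = (INF e\<in>{0<..}. principal {(x, y). dist x y < e})"

definition open_C0 :: "('a, 'b) C0 set \<Rightarrow> bool" where
  "open_C0 U \<longleftrightarrow> (\<forall>x\<in>U. \<forall>\<^sub>F (x', y) in uniformity. x' = x \<longrightarrow> y \<in> U)"

instance
proof
  fix F G :: "('a, 'b) C0" and c :: real
  have le: "norm (apply_C0 H t) \<le> norm H" for H :: "('a, 'b) C0" and t
    unfolding norm_C0_def by (rule cSUP_upper[OF _ bdd_above_apply_C0]) simp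
  show "norm F = 0 \<longleftrightarrow> F = 0"
  proof
    assume "norm F = 0"
    then have "apply_C0 F t = 0" for t using le[of F t] by simp
    then show "F = 0" by transfer (auto simp: fun_eq_iff)
  next
    assume "F = 0"
    then show "norm F = 0" by (simp add: norm_C0_def zero_C0.rep_eq)
  qed
  show "norm (F + G) \<le> norm F + norm G"
    unfolding norm_C0_def[of "F + G"]
  proof (rule cSUP_least)
    fix t
    show "norm (apply_C0 (F + G) t) \<le> norm F + norm G"
      using le[of F t] le[of G t] norm_triangle_ineq[of "apply_C0 F t" "apply_C0 G t"]
      by (simp add: plus_C0.rep_eq)
  qed simp
  have scale: "norm (c *\<^sub>R F) \<le> \<bar>c\<bar> * norm F" for c and F :: "('a, 'b) C0"
    unfolding norm_C0_def[of "c *\<^sub>R F"]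
    by (rule cSUP_least) (auto simp: scaleR_C0.rep_eq intro: mult_left_mono le)
  show "norm (c *\<^sub>R F) = \<bar>c\<bar> * norm F"
  proof (cases "c = 0")
    case True
    then show ?thesis by (simp add: norm_C0_def zero_C0.rep_eq)
  next
    case False
    with scale[of "inverse c" "c *\<^sub>R F"] have "\<bar>c\<bar> * norm F \<le> norm (c *\<^sub>R F)"
      by (simp add: field_simps)
    with scale[of c F] show ?thesis by linarith
  qed
qed (simp_all add: dist_C0_def sgn_C0_def uniformity_C0_def open_C0_def)

end


section \<open>The space $c_{00}$\<close>

typedef c00 = "{x :: nat \<Rightarrow> real. finite {n. x n \<noteq> 0}}"
  morphisms apply_c00 Abs_c00
  by (rule exI[of _ "\<lambda>_. 0"]) simp

setup_lifting type_definition_c00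

lemma finite_support_c00: "finite {n. apply_c00 x n \<noteq> 0}"
  using apply_c00[of x] by simp

lemma finite_support_plus:
  fixes x y :: "nat \<Rightarrow> real"
  assumes "finite {n. x n \<noteq> 0}" "finite {n. y n \<noteq> 0}"
  shows "finite {n. x n + y n \<noteq> 0}"
  by (rule finite_subset[OF _ finite_UnI[OF assms]]) auto

lemma finite_support_minus:
  fixes x y :: "nat \<Rightarrow> real"
  assumes "finite {n. x n \<noteq> 0}" "finite {n. y n \<noteq> 0}"
  shows "finite {n. x n \<noteq> y n}"
  by (rule finite_subset[OF _ finite_UnI[OF assms]]) auto

lemma bdd_above_apply_c00: "bdd_above (range (\<lambda>n. \<bar>apply_c00 x n\<bar>))"
proof -
  have "range (\<lambda>n. \<bar>apply_c00 x n\<bar>) \<subseteq>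
      insert 0 ((\<lambda>n. \<bar>apply_c00 x n\<bar>) ` {n. apply_c00 x n \<noteq> 0})"
    by auto
  then have "finite (range (\<lambda>n. \<bar>apply_c00 x n\<bar>))"
    by (rule finite_subset) (simp add: finite_support_c00)
  then show ?thesis by (rule bdd_above_finite)
qed

instantiation c00 :: real_vector
begin

lift_definition zero_c00 :: c00 is "\<lambda>_. 0"
  by simp

lift_definition plus_c00 :: "c00 \<Rightarrow> c00 \<Rightarrow> c00" is "\<lambda>x y n. x n + y n"
  using finite_support_plus by simp

lift_definition scaleR_c00 :: "real \<Rightarrow> c00 \<Rightarrow> c00" is "\<lambda>c x n. c * x n"
  by (auto elim!: rev_finite_subset)

lift_definition uminus_c00 :: "c00 \<Rightarrow> c00" is "\<lambda>x n. - x n"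
  by simp

lift_definition minus_c00 :: "c00 \<Rightarrow> c00 \<Rightarrow> c00" is "\<lambda>x y n. x n - y n"
  using finite_support_minus by simp

instance
  by standard (transfer, simp add: fun_eq_iff algebra_simps)+

end

instantiation c00 :: real_normed_vector
begin

definition norm_c00 :: "c00 \<Rightarrow> real" where
  "norm_c00 x = (SUP n. \<bar>apply_c00 x n\<bar>)"

definition dist_c00 :: "c00 \<Rightarrow> c00 \<Rightarrow> real" where
  "dist_c00 x y = norm (x - y)"

definition sgn_c00 :: "c00 \<Rightarrow> c00" where
  "sgn_c00 x = inverse (norm x) *\<^sub>R x"

definition uniformity_c00 :: "(c00 \<times> c00) filter" where
  "uniformity_c00 = (INF e\<in>{0<..}. principal {(x, y). dist x y < e})"

definition open_c00 :: "c00 set \<Rightarrow> bool" where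
  "open_c00 U \<longleftrightarrow> (\<forall>x\<in>U. \<forall>\<^sub>F (x', y) in uniformity. x' = x \<longrightarrow> y \<in> U)"

instance
proof
  fix x y :: c00 and c :: real
  have le: "\<bar>apply_c00 z n\<bar> \<le> norm z" for z n
    unfolding norm_c00_def by (rule cSUP_upper[OF _ bdd_above_apply_c00]) simp
  show "norm x = 0 \<longleftrightarrow> x = 0"
  proof
    assume "norm x = 0"
    then have "apply_c00 x n = 0" for n using le[of x n] by simp
    then show "x = 0" by transfer (auto simp: fun_eq_iff)
  next
    assume "x = 0"
    then show "norm x = 0" by (simp add: norm_c00_def zero_c00.rep_eq)
  qed
  show "norm (x + y) \<le> norm x + norm y"
    unfolding norm_c00_def[of "x + y"]
  proof (rule cSUP_least)
    fix n
    show "\<bar>apply_c00 (x + y) n\<bar> \<le> norm x + norm y"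
      using le[of x n] le[of y n] by (simp add: plus_c00.rep_eq)
  qed simp
  have scale: "norm (c *\<^sub>R x) \<le> \<bar>c\<bar> * norm x" for c and x :: c00
    unfolding norm_c00_def[of "c *\<^sub>R x"]
    by (rule cSUP_least) (auto simp: scaleR_c00.rep_eq abs_mult intro: mult_left_mono le)
  show "norm (c *\<^sub>R x) = \<bar>c\<bar> * norm x"
  proof (cases "c = 0")
    case True
    then show ?thesis by (simp add: norm_c00_def zero_c00.rep_eq)
  next
    case False
    with scale[of "inverse c" "c *\<^sub>R x"] have "\<bar>c\<bar> * norm x \<le> norm (c *\<^sub>R x)"
      by (simp add: field_simps)
    with scale[of c x] show ?thesis by linarith
  qed
qed (simp_all add: dist_c00_def sgn_c00_def uniformity_c00_def open_c00_def)

end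

text \<open>
  The inverse \<open>g\<close> of a linear bijection is linear on \<open>S\<close>, so linearity is required of
  \<open>f\<close> only.
\<close>

definition contains_copy_of_c00 :: "'v::real_normed_vector set \<Rightarrow> bool" where
  "contains_copy_of_c00 R \<longleftrightarrow>
     (\<exists>S \<subseteq> R. subspace S \<and> (\<exists>(f :: c00 \<Rightarrow> 'v) g. linear f \<and> homeomorphism UNIV S f g))"


section \<open>The norm of a not necessarily bounded linear operator\<close>

text \<open>Unlike \<^const>\<open>onorm\<close>, this takes the value \<open>\<infinity>\<close> on unbounded operators.\<close>

definition ennorm_op :: "('v::real_normed_vector \<Rightarrow> 'w::real_normed_vector) \<Rightarrow> ennreal" where
  "ennorm_op S = (SUP F\<in>{F. norm F \<le> 1}. ennreal (norm (S F)))"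

end

theory Submission
  imports Defs
begin

text \<open>
  The upper bound in the Daugavet equality is the triangle inequality, and an unbounded
  \<open>T\<close> makes both sides infinite. So let \<open>T\<close> be bounded, let \<open>F\<close> be in the unit ball and let
  \<open>t \<in> L\<close>; it suffices to find \<open>H\<close> in the unit ball for which \<open>\<parallel>H + T H\<parallel>\<close> is almost
  \<open>1 + \<parallel>(T F) t\<parallel>\<close>.

  Put \<open>y = (T F) t\<close> and choose a unit vector \<open>x\<close> in the direction of \<open>y\<close>, so that
  \<open>\<parallel>x + y\<parallel> = 1 + \<parallel>y\<parallel>\<close>. Near \<open>t\<close> the values of \<open>T F\<close> are close to \<open>y\<close>. Change \<open>F\<close> near \<open>t\<close> so
  that it takes the value \<open>x\<close> at some point \<open>s\<close>: with a bump function \<open>\<phi>\<close> that is \<open>1\<close> at \<open>s\<close>,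
  the convex combination \<open>H = (1 - \<phi>) F + \<phi> x = F + G\<close> stays in the unit ball. If \<open>T G\<close>
  is small, then \<open>(H + T H) s\<close> is close to \<open>x + y\<close> and \<open>H\<close> is as desired.

  Since \<open>L\<close> has no isolated points, there is room near \<open>t\<close> for infinitely many disjointly
  supported perturbations \<open>G\<^sub>n\<close> of this kind (\<open>disjoint_open_sequence\<close>). If no \<open>T G\<^sub>n\<close> is small,
  then the \<open>T G\<^sub>n\<close> are bounded away from \<open>0\<close>, whereas all their linear combinations with
  coefficients in \<open>[-1, 1]\<close> are uniformly bounded, because the \<open>G\<^sub>n\<close> have disjoint supports.
  By the lemma \<open>contains_copy_of_c00I\<close>, a theorem of Bessaga and Pelczynski in essence, a
  subsequence of the \<open>T G\<^sub>n\<close> then spans a copy of \<open>c\<^sub>0\<^sub>0\<close> in the range of \<open>T\<close>, which is excluded.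

  The usual proofs of that lemma take norming functionals from the Hahn-Banach theorem. Here
  an averaging argument (\<open>selection_step\<close>) replaces them: adding one more vector of a late
  index to an element of a fixed compact set hardly decreases its norm, since otherwise
  averages of many such sums would have a smaller norm as well, although they tend to the
  element itself.
\<close>

section \<open>Sequences with bounded sums that span a copy of $c_{00}$\<close>

text \<open>
  Suppose that all late \<open>u n\<close> violate the inequality, with witnesses in \<open>K \<times> [-1, 1]\<close>. By
  compactness a subsequence of the witnesses converges, so one pair \<open>(x, b)\<close> violates it, up to
  a loss of \<open>\<epsilon> / 2\<close>, for infinitely many \<open>n\<close>. The average of \<open>x + b u n\<close> over \<open>m\<close> of these \<open>n\<close>
  then has norm at most \<open>\<parallel>x\<parallel> - \<epsilon> / 2\<close>; but it differs from \<open>x\<close> by at most \<open>C / m\<close>.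
\<close>

lemma selection_step:
  fixes u :: "nat \<Rightarrow> 'v::real_normed_vector"
  assumes C: "\<And>A. finite A \<Longrightarrow> norm (\<Sum>i\<in>A. u i) \<le> C"
    and K: "compact K" and "\<epsilon> > 0"
  shows "\<exists>n>N. \<forall>x\<in>K. \<forall>b\<in>{-1..1::real}. norm x \<le> norm (x + b *\<^sub>R u n) + \<epsilon>"
proof (rule ccontr)
  assume "\<not> ?thesis"
  then have "\<forall>n. \<exists>z\<in>K \<times> {-1..1::real}.
      norm (fst z + snd z *\<^sub>R u (Suc N + n)) + \<epsilon> < norm (fst z)"
    by (force simp: not_le)
  then obtain z where zK: "\<And>n. z n \<in> K \<times> {-1..1::real}"
    and z: "\<And>n. norm (fst (z n) + snd (z n) *\<^sub>R u (Suc N + n)) + \<epsilon> < norm (fst (z n))"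
    by metis
  have "compact (K \<times> {-1..1::real})"
    using K by (intro compact_Times) auto
  then obtain l r where "strict_mono r" and lim: "(z \<circ> r) \<longlonglongrightarrow> l"
    using zK unfolding compact_def by meson
  define x b where "x = fst l" and "b = snd l"
  have "0 \<le> C" using C[of "{}"] by simp
  have bdu: "norm (u i) \<le> C" for i using C[of "{i}"] by simp
  have lim1: "(\<lambda>n. fst (z (r n))) \<longlonglongrightarrow> x" and lim2: "(\<lambda>n. snd (z (r n))) \<longlonglongrightarrow> b"
    using tendsto_fst[OF lim] tendsto_snd[OF lim] by (simp_all add: x_def b_def o_def)
  have "\<forall>\<^sub>F n in sequentially. dist (fst (z (r n))) x < \<epsilon> / 8"
    using lim1 \<open>\<epsilon> > 0\<close> by (intro tendstoD) auto
  moreover have "\<forall>\<^sub>F n in sequentially. dist (snd (z (r n))) b < \<epsilon> / 4 / (C + 1)"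
    using lim2 \<open>\<epsilon> > 0\<close> \<open>0 \<le> C\<close> by (intro tendstoD) auto
  ultimately have "\<forall>\<^sub>F n in sequentially. norm (x + b *\<^sub>R u (Suc N + r n)) \<le> norm x - \<epsilon> / 2"
  proof eventually_elim
    case (elim n)
    define y c v where "y = fst (z (r n))" and "c = snd (z (r n))" and "v = u (Suc N + r n)"
    have 1: "norm (x - y) < \<epsilon> / 8" "\<bar>b - c\<bar> < \<epsilon> / 4 / (C + 1)"
      using elim by (auto simp: y_def c_def dist_norm norm_minus_commute abs_minus_commute)
    have "\<bar>b - c\<bar> * norm v \<le> \<epsilon> / 4 / (C + 1) * (C + 1)"
      using 1 bdu[of "Suc N + r n"] \<open>0 \<le> C\<close> by (intro mult_mono) (auto simp: v_def)
    also have "\<dots> = \<epsilon> / 4" using \<open>0 \<le> C\<close> by (intro nonzero_eq_divide_eq[THEN iffD1] refl) simp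
    finally have 2: "norm ((b - c) *\<^sub>R v) \<le> \<epsilon> / 4" by simp
    have "norm (x + b *\<^sub>R v) \<le> norm (y + c *\<^sub>R v) + norm (x - y) + norm ((b - c) *\<^sub>R v)"
      using norm_triangle_ineq[of "y + c *\<^sub>R v" "(x - y) + (b - c) *\<^sub>R v"]
        norm_triangle_ineq[of "x - y" "(b - c) *\<^sub>R v"] by (simp add: algebra_simps)
    moreover have "norm (y + c *\<^sub>R v) + \<epsilon> < norm y"
      using z[of "r n"] by (simp add: y_def c_def v_def)
    moreover have "norm y \<le> norm x + norm (x - y)"
      using norm_triangle_ineq4[of x "x - y"] by simp
    ultimately show ?case using 1 2 by (fold v_def) linarith
  qed
  then obtain n0 where n0: "\<And>n. n \<ge> n0 \<Longrightarrow> norm (x + b *\<^sub>R u (Suc N + r n)) \<le> norm x - \<epsilon> / 2"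
    unfolding eventually_sequentially by blast
  have "l \<in> K \<times> {-1..1}"
    using closed_sequentially[OF compact_imp_closed[OF \<open>compact (K \<times> {-1..1::real})\<close>] _ lim] zK
    by (simp add: o_def)
  then have "\<bar>b\<bar> \<le> 1" by (auto simp: b_def)
  \<comment> \<open>Sum over \<open>m\<close> of the bad indices, multiplied out to avoid dividing by \<open>m\<close>.\<close>
  obtain m :: nat where m: "2 * C / \<epsilon> < real m" using reals_Archimedean2 by blast
  have "m > 0" using m \<open>0 \<le> C\<close> \<open>\<epsilon> > 0\<close> by (cases m) (auto simp: divide_less_0_iff not_less)
  define I where "I = {n0..<n0 + m}"
  define g where "g n = Suc N + r n" for n
  have "inj_on g I"
    using strict_mono_eq[OF \<open>strict_mono r\<close>] by (auto simp: inj_on_def g_def)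
  then have sumu: "norm (\<Sum>n\<in>I. u (g n)) \<le> C"
    using C[of "g ` I"] by (simp add: sum.reindex I_def)
  have "real m *\<^sub>R x = (\<Sum>n\<in>I. x + b *\<^sub>R u (g n)) - b *\<^sub>R (\<Sum>n\<in>I. u (g n))"
    by (simp add: sum.distrib scaleR_sum_right I_def sum_constant_scaleR)
  then have "real m * norm x
      \<le> norm (\<Sum>n\<in>I. x + b *\<^sub>R u (g n)) + norm (b *\<^sub>R (\<Sum>n\<in>I. u (g n)))"
    by (metis norm_scaleR norm_triangle_ineq4 abs_of_nat)
  also have "norm (\<Sum>n\<in>I. x + b *\<^sub>R u (g n)) \<le> real (card I) * (norm x - \<epsilon> / 2)"
    by (rule sum_norm_bound) (use n0 in \<open>auto simp: I_def g_def\<close>)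
  also have "norm (b *\<^sub>R (\<Sum>n\<in>I. u (g n))) \<le> C"
    using mult_mono[OF \<open>\<bar>b\<bar> \<le> 1\<close> sumu] by simp
  finally have "real m * \<epsilon> \<le> 2 * C" by (simp add: I_def algebra_simps)
  then show False using m \<open>\<epsilon> > 0\<close> by (simp add: field_simps)
qed

text \<open>
  Choose the indices one after another so that, by the selection step for the compact set of
  all combinations of the vectors chosen before, no partial sum
  \<open>p k = (\<Sum>i<k. a i *\<^sub>R u (m i))\<close> has a norm exceeding that of its successor by more than a
  summable error. Hence, up to the total error, every partial sum is bounded by the full
  sum, and so is \<open>a j *\<^sub>R u (m j) = p (Suc j) - p j\<close>, up to a factor of 2.
\<close>

lemma subsequence_bounded_below:
  fixes u :: "nat \<Rightarrow> 'v::real_normed_vector"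
  assumes C: "\<And>A. finite A \<Longrightarrow> norm (\<Sum>i\<in>A. u i) \<le> C"
    and \<delta>: "\<delta> > 0" "\<And>n. norm (u n) \<ge> \<delta>"
  shows "\<exists>m::nat \<Rightarrow> nat. strict_mono m \<and> (\<forall>a N j. (\<forall>i. \<bar>a i\<bar> \<le> 1) \<longrightarrow> j < N \<longrightarrow> \<bar>a j\<bar> = 1 \<longrightarrow>
           \<delta> / 4 \<le> norm (\<Sum>i<N. a i *\<^sub>R u (m i)))"
proof -
  define \<epsilon> :: "nat \<Rightarrow> real" where "\<epsilon> k = \<delta> / 8 * (1 / 2) ^ k" for k
  \<comment> \<open>A state is the last chosen index together with the compact set of all combinations, with
      coefficients in \<open>[-1, 1]\<close>, of the vectors chosen so far. The index of the initial
      state is a dummy.\<close>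
  define good where "good k s t \<longleftrightarrow> fst s < fst t \<and>
      (\<forall>x\<in>snd s. \<forall>b\<in>{-1..1::real}. norm x \<le> norm (x + b *\<^sub>R u (fst t)) + \<epsilon> k) \<and>
      snd t = (\<lambda>(x, b). x + b *\<^sub>R u (fst t)) ` (snd s \<times> {-1..1::real})"
    for k and s t :: "nat \<times> 'v set"
  have "\<exists>s. \<forall>k. (0 \<in> snd (s k) \<and> compact (snd (s k))) \<and> good k (s k) (s (Suc k))"
  proof (rule dependent_nat_choice)
    show "\<exists>s :: nat \<times> 'v set. 0 \<in> snd s \<and> compact (snd s)"
      by (rule exI[of _ "(0, {0})"]) simp
  next
    fix s :: "nat \<times> 'v set" and k
    assume s: "0 \<in> snd s \<and> compact (snd s)"
    have "\<epsilon> k > 0" using \<delta> by (simp add: \<epsilon>_def)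
    from selection_step[OF C _ this, of "snd s" "fst s"] s obtain n where
      n: "n > fst s" "\<forall>x\<in>snd s. \<forall>b\<in>{-1..1::real}. norm x \<le> norm (x + b *\<^sub>R u n) + \<epsilon> k"
      by blast
    let ?K = "(\<lambda>(x, b). x + b *\<^sub>R u n) ` (snd s \<times> {-1..1::real})"
    have "compact ?K"
      using s by (intro compact_continuous_image compact_Times)
        (auto intro!: continuous_intros simp: case_prod_unfold)
    moreover have "0 \<in> ?K" using s by (force intro!: image_eqI[of _ _ "(0, 0)"])
    ultimately show "\<exists>t. (0 \<in> snd t \<and> compact (snd t)) \<and> good k s t"
      using n by (intro exI[of _ "(n, ?K)"]) (simp add: good_def)
  qed
  then obtain s where s: "\<And>k. good k (s k) (s (Suc k))" and s0: "0 \<in> snd (s 0)" by blast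
  define m where "m k = fst (s (Suc k))" for k
  show ?thesis
  proof (intro exI[of _ m] conjI)
    show "strict_mono m"
      using s by (auto simp: strict_mono_Suc_iff m_def good_def)
  next
    show "\<forall>a N j. (\<forall>i. \<bar>a i\<bar> \<le> 1) \<longrightarrow> j < N \<longrightarrow> \<bar>a j\<bar> = 1 \<longrightarrow>
           \<delta> / 4 \<le> norm (\<Sum>i<N. a i *\<^sub>R u (m i))"
    proof (intro allI impI)
      fix a :: "nat \<Rightarrow> real" and N j :: nat
      assume a: "\<forall>i. \<bar>a i\<bar> \<le> 1" and "j < N" and aj: "\<bar>a j\<bar> = 1"
      define p where "p k = (\<Sum>i<k. a i *\<^sub>R u (m i))" for k
      have a': "a i \<in> {-1..1}" for i using a[rule_format, of i] by auto
      have p_Suc: "p (Suc k) = p k + a k *\<^sub>R u (m k)" for k by (simp add: p_def)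
      have pK: "p k \<in> snd (s k)" for k
      proof (induction k)
        case 0
        then show ?case using s0 by (simp add: p_def)
      next
        case (Suc k)
        then show ?case using s[of k] a'[of k]
          unfolding good_def p_Suc m_def by auto
      qed
      \<comment> \<open>The subtracted term is the sum of the errors \<open>\<epsilon> i\<close> over \<open>i \<ge> k\<close>.\<close>
      define q where "q k = norm (p k) - \<delta> / 4 * (1 / 2) ^ k" for k
      have "q k \<le> q (Suc k)" for k
      proof -
        have "norm (p k) \<le> norm (p (Suc k)) + \<epsilon> k"
          using s[of k] pK[of k] a'[of k] unfolding good_def p_Suc m_def by blast
        then show ?thesis by (simp add: q_def \<epsilon>_def)
      qed
      then have q_mono: "q k \<le> q N" if "k \<le> N" for k
        using lift_Suc_mono_le[of q] that by blast
      have p_le: "norm (p k) \<le> norm (p N) + \<delta> / 4" if "k \<le> N" for k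
      proof -
        have "\<delta> / 4 * (1 / 2) ^ k \<le> \<delta> / 4 * 1" and "\<delta> / 4 * (1 / 2) ^ N \<ge> 0"
          using \<delta> by (auto intro!: mult_left_mono power_le_one)
        then show ?thesis using q_mono[OF that] unfolding q_def by linarith
      qed
      have "\<delta> \<le> norm (p (Suc j) - p j)" using \<delta>(2) aj by (simp add: p_Suc)
      also have "\<dots> \<le> norm (p (Suc j)) + norm (p j)" by (rule norm_triangle_ineq4)
      also have "\<dots> \<le> 2 * norm (p N) + \<delta> / 2"
        using p_le[of j] p_le[of "Suc j"] \<open>j < N\<close> by simp
      finally show "\<delta> / 4 \<le> norm (\<Sum>i<N. a i *\<^sub>R u (m i))" by (simp add: p_def)
    qed
  qed
qed

text \<open>
  On the subsequence just chosen, mapping the unit vectors of \<open>c\<^sub>0\<^sub>0\<close> to \<open>u (m i)\<close> gives a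
  linear map that is bounded by the assumption on the sums and bounded below by the
  choice of the subsequence.
\<close>

lemma contains_copy_of_c00I:
  fixes u :: "nat \<Rightarrow> 'v::real_normed_vector"
  assumes R: "subspace R" "\<And>n. u n \<in> R"
    and C: "\<And>A b. finite A \<Longrightarrow> (\<And>i. \<bar>b i\<bar> \<le> 1) \<Longrightarrow> norm (\<Sum>i\<in>A. b i *\<^sub>R u i) \<le> C"
    and \<delta>: "\<delta> > 0" "\<And>n. norm (u n) \<ge> \<delta>"
  shows "contains_copy_of_c00 R"
proof -
  have sums: "norm (\<Sum>i\<in>A. u i) \<le> C" if "finite A" for A
    using C[OF that, of "\<lambda>_. 1"] by simp
  obtain m :: "nat \<Rightarrow> nat" where m: "strict_mono m" and
    lower: "\<forall>a N j. (\<forall>i. \<bar>a i\<bar> \<le> 1) \<longrightarrow> j < N \<longrightarrow> \<bar>a j\<bar> = 1 \<longrightarrow>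
           \<delta> / 4 \<le> norm (\<Sum>i<N. a i *\<^sub>R u (m i))"
    using subsequence_bounded_below[OF sums \<delta>] by blast
  have upper: "norm (\<Sum>i<N. a i *\<^sub>R u (m i)) \<le> C" if "\<And>i. \<bar>a i\<bar> \<le> 1" for a N
  proof -
    have "inj m" using m by (rule strict_mono_imp_inj_on)
    then show ?thesis
      using C[of "m ` {..<N}" "\<lambda>i. a (inv m i)"] that
      by (simp add: sum.reindex inj_on_subset)
  qed
  define f :: "c00 \<Rightarrow> 'v" where "f x = (\<Sum>i | apply_c00 x i \<noteq> 0. apply_c00 x i *\<^sub>R u (m i))" for x
  have f_eq: "f x = (\<Sum>i<N. apply_c00 x i *\<^sub>R u (m i))"
    if "{i. apply_c00 x i \<noteq> 0} \<subseteq> {..<N}" for x N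
    unfolding f_def using that by (intro sum.mono_neutral_left) auto
  have ex_N: "\<exists>N. {i. apply_c00 x i \<noteq> 0} \<subseteq> {..<N}" for x
    using finite_nat_bounded[OF finite_support_c00] .
  have "linear f"
  proof (rule linearI)
    fix x y :: c00 and c :: real
    obtain N1 N2 where "{i. apply_c00 x i \<noteq> 0} \<subseteq> {..<N1}" "{i. apply_c00 y i \<noteq> 0} \<subseteq> {..<N2}"
      using ex_N by meson
    then have x: "{i. apply_c00 x i \<noteq> 0} \<subseteq> {..<max N1 N2}"
      and y: "{i. apply_c00 y i \<noteq> 0} \<subseteq> {..<max N1 N2}"
      by (simp_all add: subset_iff less_max_iff_disj)
    then have "{i. apply_c00 (x + y) i \<noteq> 0} \<subseteq> {..<max N1 N2}"
      by (force simp: plus_c00.rep_eq)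
    then show "f (x + y) = f x + f y"
      by (simp add: f_eq[OF x] f_eq[OF y] f_eq[of "x + y"] plus_c00.rep_eq scaleR_add_left sum.distrib)
    have "{i. apply_c00 (c *\<^sub>R x) i \<noteq> 0} \<subseteq> {..<max N1 N2}"
      using x by (force simp: scaleR_c00.rep_eq)
    then show "f (c *\<^sub>R x) = c *\<^sub>R f x"
      by (simp add: f_eq[OF x] f_eq[of "c *\<^sub>R x"] scaleR_c00.rep_eq scaleR_sum_right)
  qed
  have f_bounds: "norm (f x) \<le> C * norm x" "\<delta> / 4 * norm x \<le> norm (f x)" for x
  proof -
    have "norm (f x) \<le> C * norm x \<and> \<delta> / 4 * norm x \<le> norm (f x)"
    proof (cases "x = 0")
      case True
      then show ?thesis using linear_0[OF \<open>linear f\<close>] by simp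
    next
      case False
      obtain N where N: "{i. apply_c00 x i \<noteq> 0} \<subseteq> {..<N}" using ex_N by blast
      have le: "\<bar>apply_c00 x i\<bar> \<le> norm x" for i
        unfolding norm_c00_def by (rule cSUP_upper[OF _ bdd_above_apply_c00]) simp
      \<comment> \<open>The supremum norm is attained, which gives the coordinate of modulus 1 that the lower
          bound requires after normalization.\<close>
      let ?S = "(\<lambda>i. \<bar>apply_c00 x i\<bar>) ` {..N}"
      have "Max ?S \<in> ?S" by (intro Max_in) auto
      then obtain j where "Max ?S = \<bar>apply_c00 x j\<bar>" by blast
      then have j: "\<bar>apply_c00 x i\<bar> \<le> \<bar>apply_c00 x j\<bar>" if "i \<le> N" for i
        using Max_ge[of ?S "\<bar>apply_c00 x i\<bar>"] that by simp
      have "norm x \<le> \<bar>apply_c00 x j\<bar>"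
        unfolding norm_c00_def
      proof (rule cSUP_least)
        fix i
        show "\<bar>apply_c00 x i\<bar> \<le> \<bar>apply_c00 x j\<bar>"
        proof (cases "i \<le> N")
          case False
          then have "apply_c00 x i = 0" using N by auto
          then show ?thesis by simp
        qed (rule j)
      qed simp
      with le[of j] have xj: "\<bar>apply_c00 x j\<bar> = norm x" by simp
      then have "apply_c00 x j \<noteq> 0" using False by auto
      then have "j < N" using N by auto
      define a where "a i = apply_c00 x i / norm x" for i
      have a: "\<bar>a i\<bar> \<le> 1" for i using le[of i] False by (simp add: a_def)
      have "f x = norm x *\<^sub>R (\<Sum>i<N. a i *\<^sub>R u (m i))"
        using False by (simp add: f_eq[OF N] a_def scaleR_sum_right)
      then have "norm (f x) = norm (\<Sum>i<N. a i *\<^sub>R u (m i)) * norm x" by simp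
      moreover have "norm (\<Sum>i<N. a i *\<^sub>R u (m i)) \<le> C" by (rule upper[OF a])
      moreover have "\<delta> / 4 \<le> norm (\<Sum>i<N. a i *\<^sub>R u (m i))"
        by (rule lower[rule_format, OF a \<open>j < N\<close>]) (use xj False in \<open>simp add: a_def\<close>)
      ultimately show ?thesis
        by (metis mult_right_mono norm_ge_zero)
    qed
    then show "norm (f x) \<le> C * norm x" "\<delta> / 4 * norm x \<le> norm (f x)" by auto
  qed
  have dist_f: "dist x y \<le> 4 / \<delta> * dist (f x) (f y)" for x y
    using f_bounds(2)[of "x - y"] \<delta>(1) by (simp add: dist_norm linear_diff[OF \<open>linear f\<close>] field_simps)
  have "bounded_linear f"
    using f_bounds(1) \<open>linear f\<close>
    by (intro bounded_linear.intro bounded_linear_axioms.intro exI[of _ C]) (simp_all add: mult.commute)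
  have "inj f"
  proof (rule injI)
    fix x y assume "f x = f y"
    then show "x = y" using dist_f[of x y] by simp
  qed
  have "homeomorphism UNIV (range f) f (inv f)"
  proof (rule homeomorphismI)
    show "continuous_on UNIV f" by (rule linear_continuous_on[OF \<open>bounded_linear f\<close>])
    have "(4 / \<delta>)-lipschitz_on (range f) (inv f)"
      using dist_f \<delta>(1) \<open>inj f\<close> by (intro lipschitz_onI) auto
    then show "continuous_on (range f) (inv f)" by (rule lipschitz_on_continuous_on)
  qed (use \<open>inj f\<close> in auto)
  moreover have "range f \<subseteq> R"
    using R by (auto simp: f_def intro!: subspace_sum subspace_scale)
  moreover have "subspace (range f)" using \<open>linear f\<close> by (simp add: linear_subspace_image)
  ultimately show ?thesis
    unfolding contains_copy_of_c00_def using \<open>linear f\<close> by blast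
qed

section \<open>Disjoint open sets and bump functions\<close>

text \<open>
  Without isolated points every non-empty open set has two points, and so it contains two
  disjoint non-empty open sets. Keep one as a term of the sequence and split the other again.
\<close>

lemma disjoint_open_sequence:
  fixes U :: "'a::{t2_space, perfect_space} set"
  assumes "open U" "U \<noteq> {}"
  obtains V where "\<And>n::nat. open (V n)" "\<And>n. V n \<noteq> {}" "\<And>n. V n \<subseteq> U" "disjoint_family V"
proof -
  have split: "\<exists>B W. open B \<and> B \<noteq> {} \<and> B \<subseteq> A \<and> open W \<and> W \<noteq> {} \<and> W \<subseteq> A \<and> B \<inter> W = {}"
    if A: "open A" "A \<noteq> {}" for A :: "'a set"
  proof -
    obtain x where "x \<in> A" using A by blast
    moreover have "A \<noteq> {x}" using A not_open_singleton by auto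
    ultimately obtain y where "y \<in> A" "x \<noteq> y" by blast
    from hausdorff[OF \<open>x \<noteq> y\<close>] obtain B W where
      "open B" "open W" "x \<in> B" "y \<in> W" "B \<inter> W = {}" by blast
    then show ?thesis using \<open>x \<in> A\<close> \<open>y \<in> A\<close> \<open>open A\<close>
      by (intro exI[of _ "A \<inter> B"] exI[of _ "A \<inter> W"]) auto
  qed
  have "\<exists>W. \<forall>n. (open (W n) \<and> W n \<noteq> {} \<and> W n \<subseteq> U) \<and>
      (W (Suc n) \<subseteq> W n \<and> (\<exists>B. open B \<and> B \<noteq> {} \<and> B \<subseteq> W n \<and> B \<inter> W (Suc n) = {}))"
  proof (rule dependent_nat_choice)
    show "\<exists>W. open W \<and> W \<noteq> {} \<and> W \<subseteq> U" using assms by blast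
    fix A :: "'a set" and n :: nat
    assume A: "open A \<and> A \<noteq> {} \<and> A \<subseteq> U"
    with split obtain B W where "open B" "B \<noteq> {}" "B \<subseteq> A" "open W" "W \<noteq> {}" "W \<subseteq> A" "B \<inter> W = {}"
      by metis
    with A show "\<exists>W. (open W \<and> W \<noteq> {} \<and> W \<subseteq> U) \<and>
        (W \<subseteq> A \<and> (\<exists>B. open B \<and> B \<noteq> {} \<and> B \<subseteq> A \<and> B \<inter> W = {}))"
      by (intro exI[of _ W]) blast
  qed
  then obtain W V where W: "\<And>n. W n \<subseteq> U" "\<And>n. W (Suc n) \<subseteq> W n" and
    V: "\<And>n::nat. open (V n)" "\<And>n. V n \<noteq> {}" "\<And>n. V n \<subseteq> W n" "\<And>n. V n \<inter> W (Suc n) = {}"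
    by metis
  have disj: "V i \<inter> V j = {}" if "i < j" for i j
  proof -
    have "W j \<subseteq> W (Suc i)" using that lift_Suc_antimono_le[of W, OF W(2), of "Suc i" j] by simp
    then show ?thesis using V(3,4) by blast
  qed
  have "disjoint_family V"
    unfolding disjoint_family_on_def
  proof (intro ballI impI)
    fix i j :: nat assume "i \<noteq> j"
    then show "V i \<inter> V j = {}" using disj[of i j] disj[of j i] by (cases i j rule: linorder_cases) auto
  qed
  moreover have "V n \<subseteq> U" for n using V(3)[of n] W(1)[of n] by blast
  ultimately show ?thesis using that[of V] V by blast
qed

lemma bump_function:
  fixes U :: "'a::t2_space set"
  assumes "locally_compact_space (euclidean :: 'a topology)" "open U" "t \<in> U"
  obtains \<phi> :: "'a \<Rightarrow> real" where "continuous_on UNIV \<phi>" "\<And>s. 0 \<le> \<phi> s" "\<And>s. \<phi> s \<le> 1"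
    "\<phi> t = 1" "\<And>s. s \<notin> U \<Longrightarrow> \<phi> s = 0"
proof -
  have "Hausdorff_space (euclidean :: 'a topology)"
    unfolding Hausdorff_space_def using hausdorff by (auto simp: disjnt_def)
  then have "completely_regular_space (euclidean :: 'a topology)"
    using assms(1) locally_compact_regular_imp_completely_regular_space by blast
  moreover have "closedin euclidean (- U)" "t \<in> topspace euclidean - (- U)"
    using assms by auto
  ultimately obtain f :: "'a \<Rightarrow> real" where
    f: "continuous_map euclidean (top_of_set {0..1}) f" "f t = 0" "f ` (- U) \<subseteq> {1}"
    unfolding completely_regular_space_def by meson
  then have "continuous_on UNIV f" "\<And>s. f s \<in> {0..1}"
    by (auto simp: continuous_map_in_subtopology)
  then show ?thesis
    using that[of "\<lambda>s. 1 - f s"] f by (force intro!: continuous_intros)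
qed

section \<open>Functions vanishing at infinity\<close>

lemma norm_apply_C0_le: "norm (apply_C0 F t) \<le> norm F"
  unfolding norm_C0_def by (rule cSUP_upper[OF _ bdd_above_apply_C0]) simp

lemma norm_C0_leI: "(\<And>t. norm (apply_C0 F t) \<le> B) \<Longrightarrow> norm F \<le> B"
  unfolding norm_C0_def by (rule cSUP_least) auto

lemma apply_C0_sum: "apply_C0 (\<Sum>i\<in>A. f i) t = (\<Sum>i\<in>A. apply_C0 (f i) t)"
  by (induction A rule: infinite_finite_induct) (simp_all add: zero_C0.rep_eq plus_C0.rep_eq)

lemma C0_supported_in_compact:
  fixes f :: "'a::t2_space \<Rightarrow> 'b::real_normed_vector"
  assumes "continuous_on UNIV f" "compact K" "\<And>s. s \<notin> K \<Longrightarrow> f s = 0"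
  obtains G where "apply_C0 G = f"
proof -
  have "compact {t. \<epsilon> \<le> norm (f t)}" if "\<epsilon> > 0" for \<epsilon>
  proof -
    have "closed {t. \<epsilon> \<le> norm (f t)}"
      using assms(1) by (intro closed_Collect_le continuous_intros)
    moreover have "{t. \<epsilon> \<le> norm (f t)} \<subseteq> K" using assms(3) that by force
    ultimately show ?thesis using assms(2) by (metis compact_Int_closed inf.absorb_iff2)
  qed
  then have "vanishing_at_infinity f" by (simp add: vanishing_at_infinity_def)
  then show ?thesis using that[of "Abs_C0 f"] assms(1) by (simp add: Abs_C0_inverse)
qed

section \<open>The Daugavet equality\<close>

lemma norm_add_unit_vector:
  fixes y :: "'b::real_normed_vector"
  assumes "\<exists>x::'b. x \<noteq> 0"
  obtains x where "norm x = 1" "norm (x + y) = 1 + norm y"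
proof (cases "y = 0")
  case True
  obtain x :: 'b where "x \<noteq> 0" using assms by blast
  then show ?thesis using that[of "sgn x"] True by (simp add: norm_sgn)
next
  case False
  have "norm y *\<^sub>R sgn y = y" using False by (simp add: sgn_div_norm)
  then have "sgn y + y = (1 + norm y) *\<^sub>R sgn y" by (simp add: scaleR_add_left)
  then have "norm (sgn y + y) = 1 + norm y" using False by (simp add: norm_sgn)
  then show ?thesis using that[of "sgn y"] False by (simp add: norm_sgn)
qed

text \<open>
  The function \<open>H\<close> takes the value \<open>x\<close> at a point where \<open>T H\<close> is within \<open>\<epsilon>\<close> of
  \<open>y = (T F) t\<close>. One half of \<open>\<epsilon>\<close> pays for the distance of \<open>T F\<close> from \<open>y\<close> at that point, the
  other half for \<open>T (H - F)\<close>.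
\<close>

lemma daugavet_perturbation:
  fixes T :: "('a::{t2_space, perfect_space}, 'b::real_normed_vector) C0 \<Rightarrow> ('a, 'b) C0"
  assumes X: "\<exists>x::'b. x \<noteq> 0"
    and L: "locally_compact_space (euclidean :: 'a topology)"
    and "linear T"
    and nocopy: "\<not> contains_copy_of_c00 (range T)"
    and C: "\<And>F. norm (T F) \<le> C * norm F"
    and F: "norm F \<le> 1" and "\<epsilon> > 0"
  obtains H where "norm H \<le> 1" "1 + norm (apply_C0 (T F) t) - \<epsilon> \<le> norm (H + T H)"
proof -
  define y where "y = apply_C0 (T F) t"
  obtain x where x: "norm x = 1" "norm (x + y) = 1 + norm y"
    using norm_add_unit_vector[OF X] by blast
  obtain U0 K where U0: "open U0" "compact K" "t \<in> U0" "U0 \<subseteq> K"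
    using L[unfolded locally_compact_space_def, rule_format, of t] by (auto simp flip: open_openin)
  \<comment> \<open>The bumps live inside the compact set \<open>K\<close>, which makes \<open>\<phi> x\<close> vanish at infinity.\<close>
  define U where "U = U0 \<inter> {s. norm (apply_C0 (T F) s - y) < \<epsilon> / 2}"
  have "open U"
    unfolding U_def using U0
    by (intro open_Int open_Collect_less continuous_intros continuous_on_apply_C0) auto
  moreover have "t \<in> U" using U0 \<open>\<epsilon> > 0\<close> by (simp add: U_def y_def)
  ultimately obtain V where V: "\<And>n::nat. open (V n)" "\<And>n. V n \<noteq> {}" "\<And>n. V n \<subseteq> U"
    and disj: "disjoint_family V"
    by (metis disjoint_open_sequence empty_iff)
  define bump where "bump n s \<phi> G \<longleftrightarrow> s \<in> V n \<and> \<phi> s = 1 \<and>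
      (\<forall>r. 0 \<le> \<phi> r \<and> \<phi> r \<le> (1::real) \<and> (r \<notin> V n \<longrightarrow> \<phi> r = 0)) \<and>
      apply_C0 G = (\<lambda>r. \<phi> r *\<^sub>R (x - apply_C0 F r))" for n s \<phi> G
  have "\<exists>s \<phi> G. bump n s \<phi> G" for n
  proof -
    obtain s where "s \<in> V n" using V by blast
    obtain \<phi> where \<phi>: "continuous_on UNIV \<phi>" "\<And>r. 0 \<le> \<phi> r" "\<And>r. \<phi> r \<le> (1::real)"
      "\<phi> s = 1" "\<And>r. r \<notin> V n \<Longrightarrow> \<phi> r = 0"
      using bump_function[OF L V(1) \<open>s \<in> V n\<close>] by blast
    have cont: "continuous_on UNIV (\<lambda>r. \<phi> r *\<^sub>R (x - apply_C0 F r))"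
      using \<phi>(1) by (intro continuous_intros continuous_on_apply_C0)
    have "\<phi> r *\<^sub>R (x - apply_C0 F r) = 0" if "r \<notin> K" for r
    proof -
      have "r \<notin> V n" using that V(3)[of n] U0 by (auto simp: U_def)
      then show ?thesis using \<phi>(5) by simp
    qed
    then obtain G where "apply_C0 G = (\<lambda>r. \<phi> r *\<^sub>R (x - apply_C0 F r))"
      using C0_supported_in_compact[OF cont U0(2)] by blast
    with \<phi> \<open>s \<in> V n\<close> have "bump n s \<phi> G" by (simp add: bump_def)
    then show ?thesis by blast
  qed
  then obtain s \<phi> G where "\<And>n. bump n (s n) (\<phi> n) (G n)" by metis
  then have s: "\<And>n. s n \<in> V n" "\<And>n. \<phi> n (s n) = 1"
    and \<phi>: "\<And>n r. 0 \<le> \<phi> n r" "\<And>n r. \<phi> n r \<le> (1::real)" "\<And>n r. r \<notin> V n \<Longrightarrow> \<phi> n r = 0"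
    and G: "\<And>n. apply_C0 (G n) = (\<lambda>r. \<phi> n r *\<^sub>R (x - apply_C0 F r))"
    unfolding bump_def by blast+
  have F_le: "norm (apply_C0 F r) \<le> 1" for r using norm_apply_C0_le[of F r] F by linarith
  have normH: "norm (F + G n) \<le> 1" for n
  proof (rule norm_C0_leI)
    fix r
    have "apply_C0 (F + G n) r = (1 - \<phi> n r) *\<^sub>R apply_C0 F r + \<phi> n r *\<^sub>R x"
      by (simp add: plus_C0.rep_eq G algebra_simps)
    also have "norm \<dots> \<le> (1 - \<phi> n r) * 1 + \<phi> n r * 1"
      using \<phi>(1,2)[of n r] F_le[of r] x
      by (intro order_trans[OF norm_triangle_ineq] add_mono) (auto intro!: mult_left_mono mult_left_le)
    finally show "norm (apply_C0 (F + G n) r) \<le> 1" by simp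
  qed
  have "\<exists>n. norm (T (G n)) < \<epsilon> / 2"
  proof (rule ccontr)
    assume "\<not> ?thesis"
    then have low: "\<epsilon> / 2 \<le> norm (T (G n))" for n by (simp add: not_less)
    \<comment> \<open>At each point at most one \<open>G i\<close> is non-zero, and its norm is at most \<open>\<parallel>x\<parallel> + \<parallel>F\<parallel> \<le> 2\<close>.\<close>
    have sumG: "norm (\<Sum>i\<in>A. b i *\<^sub>R G i) \<le> 2" if "finite A" "\<And>i. \<bar>b i\<bar> \<le> 1" for A b
    proof (rule norm_C0_leI)
      fix r
      have eq: "apply_C0 (\<Sum>i\<in>A. b i *\<^sub>R G i) r = (\<Sum>i\<in>A. b i *\<^sub>R apply_C0 (G i) r)"
        by (simp add: apply_C0_sum scaleR_C0.rep_eq)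
      have G0: "apply_C0 (G i) r = 0" if "r \<notin> V i" for i using that by (simp add: G \<phi>(3))
      show "norm (apply_C0 (\<Sum>i\<in>A. b i *\<^sub>R G i) r) \<le> 2"
      proof (cases "\<exists>i\<in>A. r \<in> V i")
        case False
        then show ?thesis unfolding eq using G0 by simp
      next
        case True
        then obtain i where i: "i \<in> A" "r \<in> V i" by blast
        then have "r \<notin> V j" if "j \<noteq> i" for j
          using disj that unfolding disjoint_family_on_def by blast
        then have "(\<Sum>j\<in>A. b j *\<^sub>R apply_C0 (G j) r) = b i *\<^sub>R apply_C0 (G i) r"
          using sum.mono_neutral_right[of A "{i}" "\<lambda>j. b j *\<^sub>R apply_C0 (G j) r"] i that(1) G0
          by auto
        moreover have "norm (apply_C0 (G i) r) \<le> 1 * 2"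
          using \<phi>(1,2)[of i r] norm_triangle_ineq4[of x "apply_C0 F r"] F_le[of r] x(1)
          unfolding G norm_scaleR by (intro mult_mono) auto
        ultimately show ?thesis
          unfolding eq using mult_mono[OF that(2)[of i], of "norm (apply_C0 (G i) r)" 2] by simp
      qed
    qed
    have sumT: "norm (\<Sum>i\<in>A. b i *\<^sub>R T (G i)) \<le> \<bar>C\<bar> * 2" if "finite A" "\<And>i. \<bar>b i\<bar> \<le> 1" for A b
    proof -
      have "(\<Sum>i\<in>A. b i *\<^sub>R T (G i)) = T (\<Sum>i\<in>A. b i *\<^sub>R G i)"
        by (simp add: linear_sum[OF \<open>linear T\<close>] linear_scale[OF \<open>linear T\<close>])
      also have "norm \<dots> \<le> \<bar>C\<bar> * norm (\<Sum>i\<in>A. b i *\<^sub>R G i)"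
        by (rule order_trans[OF C]) (auto intro!: mult_right_mono)
      also have "\<dots> \<le> \<bar>C\<bar> * 2" using sumG[OF that] by (intro mult_left_mono) auto
      finally show ?thesis .
    qed
    have "contains_copy_of_c00 (range T)"
      using contains_copy_of_c00I[of "range T" "\<lambda>n. T (G n)" "\<bar>C\<bar> * 2" "\<epsilon> / 2"] sumT low \<open>\<epsilon> > 0\<close>
        linear_subspace_image[OF \<open>linear T\<close> subspace_UNIV] by auto
    with nocopy show False ..
  qed
  then obtain n where n: "norm (T (G n)) < \<epsilon> / 2" by blast
  define H where "H = F + G n"
  let ?r = "s n" and ?d = "apply_C0 (T F) (s n) - y"
  have "apply_C0 (H + T H) ?r = (x + y) + (?d + apply_C0 (T (G n)) ?r)"
    by (simp add: H_def plus_C0.rep_eq G s(2) linear_add[OF \<open>linear T\<close>])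
  moreover have "norm ?d < \<epsilon> / 2" using s(1)[of n] V(3)[of n] by (auto simp: U_def)
  moreover have "norm (apply_C0 (T (G n)) ?r) < \<epsilon> / 2"
    using norm_apply_C0_le[of "T (G n)" ?r] n by linarith
  ultimately have "1 + norm y - \<epsilon> \<le> norm (apply_C0 (H + T H) ?r)"
    using norm_triangle_ineq[of ?d "apply_C0 (T (G n)) ?r"] x(2)
      norm_diff_ineq[of "x + y" "?d + apply_C0 (T (G n)) ?r"] by simp
  also have "\<dots> \<le> norm (H + T H)" by (rule norm_apply_C0_le)
  finally show ?thesis using that[of H] normH by (simp add: H_def y_def)
qed

lemma ennorm_op_upper: "norm F \<le> 1 \<Longrightarrow> ennreal (norm (S F)) \<le> ennorm_op S"
  unfolding ennorm_op_def by (rule SUP_upper) simp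

theorem theorem2p1:
  fixes T :: "('a::{t2_space, perfect_space}, 'b::banach) C0 \<Rightarrow> ('a, 'b) C0"
  assumes "\<exists>x::'b. x \<noteq> 0"
    and "locally_compact_space (euclidean :: 'a topology)"
    and "linear T"
    and "\<not> contains_copy_of_c00 (range T)"
  shows "ennorm_op (\<lambda>F. id F + T F) = 1 + ennorm_op T"
proof (rule antisym)
  show "ennorm_op (\<lambda>F. id F + T F) \<le> 1 + ennorm_op T"
    unfolding ennorm_op_def[of "\<lambda>F. id F + T F"]
  proof (rule SUP_least)
    fix F :: "('a, 'b) C0" assume "F \<in> {F. norm F \<le> 1}"
    then have F: "norm F \<le> 1" by simp
    have "ennreal (norm (id F + T F)) \<le> ennreal (1 + norm (T F))"
      using norm_triangle_ineq[of F "T F"] F by (intro ennreal_leI) simp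
    also have "\<dots> \<le> 1 + ennorm_op T"
      using ennorm_op_upper[OF F, of T] by (simp add: ennreal_plus add_left_mono)
    finally show "ennreal (norm (id F + T F)) \<le> 1 + ennorm_op T" .
  qed
next
  let ?N = "ennorm_op (\<lambda>F. id F + T F)"
  show "1 + ennorm_op T \<le> ?N"
  proof (cases "?N = \<infinity>")
    case False
    then obtain N where N: "?N = ennreal N" "N \<ge> 0" by (cases ?N) auto
    \<comment> \<open>If \<open>\<parallel>I + T\<parallel> = N\<close> is finite, then \<open>\<parallel>T\<parallel> \<le> N + 1\<close>, so the perturbation argument applies.\<close>
    have le_N: "norm (F + T F) \<le> N" if "norm F \<le> 1" for F
      using ennorm_op_upper[OF that, of "\<lambda>F. id F + T F"] N by simp
    have bdd1: "norm (T F) \<le> N + 1" if "norm F \<le> 1" for F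
      using le_N[OF that] norm_triangle_ineq4[of "F + T F" F] that by simp
    have bdd: "norm (T F) \<le> (N + 1) * norm F" for F
    proof (cases "F = 0")
      case True
      then show ?thesis using linear_0[OF \<open>linear T\<close>] by simp
    next
      case False
      then have "norm (T (sgn F)) \<le> N + 1" by (intro bdd1) (simp add: norm_sgn)
      then show ?thesis using False
        by (simp add: sgn_div_norm linear_scale[OF \<open>linear T\<close>] field_simps)
    qed
    have T_le: "norm (T F) \<le> N - 1" if F: "norm F \<le> 1" for F
    proof (rule norm_C0_leI, rule field_le_epsilon)
      fix t and \<epsilon> :: real assume "\<epsilon> > 0"
      obtain H where "norm H \<le> 1" "1 + norm (apply_C0 (T F) t) - \<epsilon> \<le> norm (H + T H)"
        using daugavet_perturbation[OF assms bdd F \<open>\<epsilon> > 0\<close>] by blast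
      with le_N[of H] show "norm (apply_C0 (T F) t) \<le> N - 1 + \<epsilon>" by linarith
    qed
    then have TN: "ennorm_op T \<le> ennreal (N - 1)"
      unfolding ennorm_op_def by (auto intro!: SUP_least ennreal_leI)
    have "N - 1 \<ge> 0"
      using T_le[of 0] by (simp add: linear_0[OF \<open>linear T\<close>])
    then have "1 + ennreal (N - 1) = ennreal N"
      by (metis add_diff_cancel_left' diff_add_cancel ennreal_1 ennreal_plus zero_le_one)
    then show ?thesis using TN N by (metis add_left_mono)
  qed simp
qed

end
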